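(* Let $n > 3$ be a prime, and let $r \in \{1,2\}$ with $n \equiv r \pmod 3$. Suppose $a, b, m$ are integers with $m \ne 0$, $a + b \neq 0$, such that $p = \frac{a^n + b^n}{a+b}$ is an odd prime and $a + b = m^n$. Then $p \equiv 1 \pmod{2n}$, and for every positive integer $k$ with $k \equiv \frac{rn-1}{3} \pmod n$ there exist positive integers $A,B,C,D$ with $\gcd(A,B,C) = p^k$ satisfying $A + B = C$ and $ABC = D^n$. *)

theory Defs
  imports Complex_Main "HOL-Number_Theory.Cong" "HOL-Computational_Algebra.Primes"
begin

end

theory Submission imports Defs "HOL-Number_Theory.Residues" begin

text \<open>
  The integers \<open>a\<close>, \<open>b\<close> are coprime, since \<open>gcd a b ^ (n - 1)\<close> divides the prime \<open>p\<close>. If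
  \<open>n\<close> did not divide \<open>p - 1\<close>, then taking \<open>n\<close>-th powers would be injective modulo \<open>p\<close>, so
  \<open>a ^ n \<equiv> (- b) ^ n\<close> would make \<open>p\<close> divide \<open>a + b = m ^ n\<close>, hence also \<open>m\<close>; this
  contradicts \<open>\<bar>a + b\<bar> ^ (n - 1) \<le> 2 ^ (n - 1) * p\<close>, a consequence of the convexity of the
  \<open>n\<close>-th power. For the second claim, multiply \<open>a ^ n + b ^ n = p * m ^ n\<close> by \<open>p ^ k\<close> and
  move negative terms to the other side: the product of the three terms is, up to sign,
  \<open>p ^ (3 * k + 1) * (a * b * m) ^ n\<close>, and \<open>n\<close> divides \<open>3 * k + 1\<close>.
\<close>

lemma add_dvd_power_add_power_odd:
  fixes a b :: "'a::comm_ring_1"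
  assumes "odd n"
  shows "a + b dvd a ^ n + b ^ n"
proof -
  obtain k where k: "n = Suc k" using assms by (cases n) auto
  have "a - (- b) dvd a ^ n - (- b) ^ n"
    unfolding k power_diff_sumr2 by simp
  then show ?thesis using assms by simp
qed

text \<open>Convexity of the \<open>n\<close>-th power at the midpoint \<open>s\<close> of
  \<open>s + t\<close> and \<open>s - t\<close>, where \<open>s - t\<close> may be negative. The
  second conjunct strengthens the induction: the step discards \<open>t * (X - Y)\<close>, which
  must be nonnegative.\<close>

lemma two_power_le_power_add_diff:
  fixes s t :: "'a::linordered_idom"
  assumes "0 \<le> s" and "0 \<le> t"
  shows "2 * s ^ n \<le> (s + t) ^ n + (s - t) ^ n \<and> (s - t) ^ n \<le> (s + t) ^ n"
proof (induction n)
  case 0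
  show ?case by simp
next
  case (Suc n)
  define X Y where XY: "X = (s + t) ^ n" "Y = (s - t) ^ n"
  have IH: "2 * s ^ n \<le> X + Y" "Y \<le> X" using Suc by (auto simp: XY)
  have "0 \<le> X + Y" using IH(1) assms by (meson order_trans mult_nonneg_nonneg zero_le_numeral zero_le_power)
  have "2 * s ^ Suc n = s * (2 * s ^ n)" by simp
  also have "\<dots> \<le> s * (X + Y)" using IH assms by (intro mult_left_mono)
  also have "\<dots> \<le> s * (X + Y) + t * (X - Y)" using IH assms by simp
  also have "\<dots> = (s + t) ^ Suc n + (s - t) ^ Suc n" by (simp add: XY algebra_simps)
  finally have 1: "2 * s ^ Suc n \<le> (s + t) ^ Suc n + (s - t) ^ Suc n" .
  have "0 \<le> s * (X - Y) + t * (X + Y)" using IH assms \<open>0 \<le> X + Y\<close> by simp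
  also have "\<dots> = (s + t) ^ Suc n - (s - t) ^ Suc n" by (simp add: XY algebra_simps)
  finally show ?case using 1 by simp
qed

lemma power_add_le_sum_powers:
  fixes a b :: "'a::linordered_idom"
  assumes "0 \<le> a + b" and "n > 0"
  shows "(a + b) ^ n \<le> 2 ^ (n - 1) * (a ^ n + b ^ n)"
proof -
  have *: "2 * (a + b) ^ n \<le> (2 * a) ^ n + (2 * b) ^ n"
    if "0 \<le> a + b" "b \<le> a" for a b :: 'a
  proof -
    \<comment> \<open>The midpoint \<open>a + b\<close> of \<open>2 * a\<close> and
      \<open>2 * b\<close> is used, which avoids halving in a ring.\<close>
    have "2 * (a + b) ^ n \<le> ((a + b) + (a - b)) ^ n + ((a + b) - (a - b)) ^ n"
      using two_power_le_power_add_diff[of "a + b" "a - b" n] that by simp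
    moreover have "(a + b) + (a - b) = 2 * a" "(a + b) - (a - b) = 2 * b"
      by (simp_all add: algebra_simps)
    ultimately show ?thesis by simp
  qed
  have "2 * (a + b) ^ n \<le> (2 * a) ^ n + (2 * b) ^ n"
    using *[of a b] *[of b a] assms(1) by (cases "b \<le> a") (simp_all add: add.commute)
  also have "\<dots> = 2 * (2 ^ (n - 1) * (a ^ n + b ^ n))"
    using assms(2) by (cases n) (simp_all add: power_mult_distrib algebra_simps)
  finally show ?thesis by simp
qed

text \<open>For \<open>a + b > 0\<close>, cancel one factor \<open>a + b\<close> in the convexity
  bound. As \<open>n\<close> is odd, replacing \<open>a\<close>, \<open>b\<close> by
  \<open>- a\<close>, \<open>- b\<close> keeps \<open>q\<close>, which settles the other
  sign.\<close>

lemma abs_add_power_le_quotient: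
  fixes a b q :: "'a::linordered_idom"
  assumes "odd n" and "q * (a + b) = a ^ n + b ^ n" and "a + b \<noteq> 0"
  shows "\<bar>a + b\<bar> ^ (n - 1) \<le> 2 ^ (n - 1) * q"
proof -
  have n: "n > 0" using assms(1) by (cases n) auto
  have *: "(a + b) ^ (n - 1) \<le> 2 ^ (n - 1) * q"
    if "q * (a + b) = a ^ n + b ^ n" "a + b > 0" for a b :: 'a
  proof -
    have "(a + b) ^ (n - 1) * (a + b) = (a + b) ^ n"
      using n by (simp add: power_eq_if mult.commute)
    also have "\<dots> \<le> 2 ^ (n - 1) * (a ^ n + b ^ n)"
      using power_add_le_sum_powers[of a b n] that n by simp
    also have "\<dots> = (2 ^ (n - 1) * q) * (a + b)" by (simp add: that(1)[symmetric] mult.assoc)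
    finally show ?thesis using that(2) by simp
  qed
  show ?thesis
  proof (cases "a + b > 0")
    case True
    then show ?thesis using * assms(2) by simp
  next
    case False
    have "q * (- a + - b) = - (q * (a + b))" by (simp add: algebra_simps)
    also have "\<dots> = (- a) ^ n + (- b) ^ n" using assms by simp
    finally show ?thesis using *[of "- a" "- b"] False assms(3) by simp
  qed
qed

text \<open>The exponent is congruent to 1 modulo \<open>p - 1\<close>; the extra factor
  \<open>x\<close> makes the congruence hold also when \<open>p\<close> divides
  \<open>x\<close>.\<close>

lemma fermat_little_cong:
  fixes p :: nat and x :: int
  assumes "prime p"
  shows "[x ^ ((p - 1) * v + 1) = x] (mod int p)"
proof (cases "int p dvd x")
  case True
  then show ?thesis by (simp add: cong_iff_dvd_diff)
next
  case False
  have "p > 0" using assms prime_gt_0_nat by blast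
  define y where "y = nat (x mod int p)"
  have y: "int y = x mod int p" using \<open>p > 0\<close> by (simp add: y_def)
  then have xy: "[x = int y] (mod int p)" by (simp add: cong_def)
  then have "\<not> p dvd y" using False by (meson cong_dvd_iff int_dvd_int_iff)
  then have "[y ^ (p - 1) = 1] (mod p)" using fermat_theorem assms by blast
  then have "[int y ^ (p - 1) = 1] (mod int p)"
    by (metis cong_int_iff of_nat_1 of_nat_power)
  then have "[x ^ (p - 1) = 1] (mod int p)"
    using xy cong_pow cong_trans by blast
  then have "[(x ^ (p - 1)) ^ v * x = 1 ^ v * x] (mod int p)"
    by (intro cong_scalar_right cong_pow)
  then show ?thesis by (simp only: power_add power_mult power_one_right power_one mult_1)
qed

text \<open>An inverse \<open>u\<close> of \<open>n\<close> modulo \<open>p - 1\<close> exists, and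
  raising to the power \<open>u\<close> undoes the \<open>n\<close>-th power.\<close>

lemma cong_of_cong_power_coprime:
  fixes p n :: nat and x y :: int
  assumes "prime p" and "odd p" and "coprime n (p - 1)"
    and "[x ^ n = y ^ n] (mod int p)"
  shows "[x = y] (mod int p)"
proof -
  \<comment> \<open>A side condition of \<open>coprime_bezout_strong\<close>; oddness excludes
    \<open>p = 2\<close>.\<close>
  have "p - 1 \<noteq> 1" using assms(2) by presburger
  then obtain u v where uv: "n * u = (p - 1) * v + 1"
    using coprime_bezout_strong assms(3) by blast
  have "[(x ^ n) ^ u = (y ^ n) ^ u] (mod int p)" using assms(4) by (rule cong_pow)
  then have "[x ^ ((p - 1) * v + 1) = y ^ ((p - 1) * v + 1)] (mod int p)"
    by (simp only: power_mult[symmetric] uv)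
  then show ?thesis
    using fermat_little_cong[OF assms(1)] by (meson cong_sym cong_trans)
qed

lemma coprime_of_prime_quotient:
  fixes a b p :: int
  assumes "odd n" and "n > 1" and "prime p"
    and "p * (a + b) = a ^ n + b ^ n" and "a + b \<noteq> 0"
  shows "coprime a b"
proof -
  define g where "g = gcd a b"
  have "g \<noteq> 0" using assms(5) by (auto simp: g_def)
  obtain a' b' where ab: "a = g * a'" "b = g * b'"
    unfolding g_def by (meson dvdE gcd_dvd1 gcd_dvd2)
  obtain w where w: "a' ^ n + b' ^ n = (a' + b') * w"
    using add_dvd_power_add_power_odd[OF assms(1)] by (meson dvdE)
  have "n = Suc (n - 1)" using assms(2) by simp
  then have gn: "g ^ n = g * g ^ (n - 1)" by (metis power_Suc)
  have "(a + b) * p = g ^ n * (a' ^ n + b' ^ n)"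
    using assms(4) by (simp add: ab power_mult_distrib algebra_simps)
  also have "\<dots> = (a + b) * (g ^ (n - 1) * w)"
    by (simp add: w gn ab algebra_simps)
  finally have "p = g ^ (n - 1) * w" using assms(5) by simp
  \<comment> \<open>Two factors \<open>g\<close> must be split off: a single one would still allow
    \<open>g\<close> to be associated to \<open>p\<close>.\<close>
  moreover have "n - 1 = Suc (Suc (n - 3))" using assms(1,2) by (cases "n = 2") auto
  ultimately have "p = g * (g * (g ^ (n - 3) * w))" by (simp add: mult.assoc)
  then have "is_unit g"
    using assms(3) by (metis dvd_mult_left irreducibleD prime_elem_imp_irreducible prime_imp_prime_elem)
  then show ?thesis by (simp add: g_def is_unit_gcd_iff coprime_iff_gcd_eq_1)
qed

text \<open>A size argument: if \<open>p\<close> divides \<open>m\<close>, then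
  \<open>\<bar>a + b\<bar> \<ge> p ^ n > 2 * p\<close>, and the convexity bound yields
  \<open>p ^ (n - 1) < p\<close>.\<close>

lemma quotient_prime_not_dvd_base:
  fixes a b m p :: int
  assumes "odd n" and "n > 1" and "prime p"
    and "p * (a + b) = a ^ n + b ^ n" and "a + b = m ^ n" and "m \<noteq> 0"
  shows "\<not> p dvd a + b"
proof
  assume "p dvd a + b"
  then have "p dvd m" using assms(3,5) prime_dvd_power by metis
  then have "p \<le> \<bar>m\<bar>" using assms(6) dvd_imp_le_int[of m p] by simp
  have "p \<ge> 2" using assms(3) prime_ge_2_int by blast
  have n3: "n \<ge> 3" using assms(1,2) by (cases "n = 2") auto
  have "2 * p \<le> p ^ 2" using \<open>p \<ge> 2\<close> by (simp add: power2_eq_square)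
  also have "\<dots> < p ^ n" using \<open>p \<ge> 2\<close> n3 by (intro power_strict_increasing) auto
  also have "\<dots> \<le> \<bar>m\<bar> ^ n" using \<open>p \<le> \<bar>m\<bar>\<close> \<open>p \<ge> 2\<close> by (intro power_mono) auto
  also have "\<dots> = \<bar>a + b\<bar>" by (simp add: assms(5) power_abs)
  finally have "2 * p < \<bar>a + b\<bar>" .
  then have "(2 * p) ^ (n - 1) < \<bar>a + b\<bar> ^ (n - 1)"
    using \<open>p \<ge> 2\<close> n3 by (intro power_strict_mono) auto
  also have "\<dots> \<le> 2 ^ (n - 1) * p"
    using abs_add_power_le_quotient[of n p a b] assms by simp
  finally have "p ^ (n - 1) < p" by (simp add: power_mult_distrib)
  moreover have "p ^ 1 \<le> p ^ (n - 1)" using \<open>p \<ge> 2\<close> n3 by (intro power_increasing) auto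
  ultimately show False by simp
qed

lemma quotient_prime_cong_1:
  fixes a b m p :: int
  assumes "prime n" and "odd n" and "prime p" and "odd p"
    and "p * (a + b) = a ^ n + b ^ n" and "a + b = m ^ n" and "m \<noteq> 0"
  shows "[p = 1] (mod 2 * int n)"
proof -
  define P where "P = nat p"
  have p: "p = int P" using assms(3) by (simp add: P_def prime_ge_0_int)
  have P: "prime P" "odd P" using assms(3,4) by (simp_all add: p)
  have "n dvd P - 1"
  proof (rule ccontr)
    assume "\<not> n dvd P - 1"
    then have "coprime n (P - 1)" using assms(1) prime_imp_coprime by blast
    \<comment> \<open>Since \<open>n\<close> is odd, \<open>a ^ n - (- b) ^ n\<close> equals
      \<open>p * (a + b)\<close>.\<close>
    moreover have "[a ^ n = (- b) ^ n] (mod int P)"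
      using assms(2) by (simp add: cong_iff_dvd_diff assms(5)[symmetric] p)
    ultimately have "[a = - b] (mod int P)" using cong_of_cong_power_coprime P by blast
    then have "p dvd a + b" by (simp add: cong_iff_dvd_diff p)
    then show False
      using quotient_prime_not_dvd_base[of n p a b m] assms prime_gt_1_nat by blast
  qed
  moreover have "2 dvd P - 1" using P by simp
  moreover have "coprime 2 n" using assms(2) by simp
  ultimately have "2 * n dvd P - 1" by (simp add: divides_mult)
  then have "[P = 1] (mod 2 * n)"
    using P(1) prime_ge_1_nat by (simp add: cong_altdef_nat)
  then show ?thesis unfolding p by (metis cong_int_iff of_nat_1 of_nat_mult of_nat_numeral)
qed

lemma abs_sum_rearrange:
  fixes x y z :: "'a::linordered_idom"
  assumes "x + y = z"
  shows "\<bar>x\<bar> + \<bar>y\<bar> = \<bar>z\<bar> \<or> \<bar>x\<bar> + \<bar>z\<bar> = \<bar>y\<bar> \<or> \<bar>y\<bar> + \<bar>z\<bar> = \<bar>x\<bar>"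
  using assms by (auto simp: abs_if)

text \<open>Passing to absolute values preserves the gcd and the size of the product; the signs only
  decide which of the three becomes the sum \<open>C\<close>.\<close>

lemma exists_positive_sum_triple:
  fixes x y z :: int
  assumes "x + y = z" and "x \<noteq> 0" "y \<noteq> 0" "z \<noteq> 0"
  shows "\<exists>A B C. A > 0 \<and> B > 0 \<and> C > 0 \<and> A + B = C \<and>
    gcd (gcd A B) C = gcd (gcd x y) z \<and> A * B * C = \<bar>x * y * z\<bar>"
  using abs_sum_rearrange[OF assms(1)]
proof (elim disjE)
  assume "\<bar>x\<bar> + \<bar>y\<bar> = \<bar>z\<bar>"
  then show ?thesis
    using assms(2-) by (intro exI[of _ "\<bar>x\<bar>"] exI[of _ "\<bar>y\<bar>"] exI[of _ "\<bar>z\<bar>"]) (simp add: abs_mult)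
next
  assume "\<bar>x\<bar> + \<bar>z\<bar> = \<bar>y\<bar>"
  then show ?thesis
    using assms(2-) by (intro exI[of _ "\<bar>x\<bar>"] exI[of _ "\<bar>z\<bar>"] exI[of _ "\<bar>y\<bar>"])
      (simp add: abs_mult ac_simps)
next
  assume "\<bar>y\<bar> + \<bar>z\<bar> = \<bar>x\<bar>"
  then show ?thesis
    using assms(2-) by (intro exI[of _ "\<bar>y\<bar>"] exI[of _ "\<bar>z\<bar>"] exI[of _ "\<bar>x\<bar>"])
      (simp add: abs_mult ac_simps)
qed

text \<open>Modulo 3, \<open>r * n\<close> is \<open>r ^ 2\<close>, hence 1, so the division by 3 is
  exact and \<open>3 * k + 1\<close> is congruent to \<open>r * n\<close> modulo
  \<open>n\<close>.\<close>

lemma dvd_three_mult_add_1: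
  fixes n r k :: nat
  assumes "n > 0" and "r \<in> {1, 2}" and "[n = r] (mod 3)" and "[k = (r * n - 1) div 3] (mod n)"
  shows "n dvd 3 * k + 1"
proof -
  have "r * n mod 3 = 1"
    using assms(2,3) by (auto simp: cong_def) presburger
  then have "3 * ((r * n - 1) div 3) + 1 = r * n" by presburger
  moreover have "[3 * k + 1 = 3 * ((r * n - 1) div 3) + 1] (mod n)"
    using assms(4) by (intro cong_add cong_scalar_left) auto
  ultimately show ?thesis by (simp add: cong_dvd_iff)
qed

theorem theorem5:
  fixes n r :: nat and a b m p :: int
  assumes "prime n" and "n > 3"
    and "r \<in> {1, 2}" and "[n = r] (mod 3)"
    and "m \<noteq> 0" and "a + b \<noteq> 0"
    and "of_int p = (of_int (a ^ n + b ^ n) / of_int (a + b) :: rat)"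
    and "prime p" and "odd p"
    and "a + b = m ^ n"
  shows "[p = 1] (mod 2 * int n) \<and>
    (\<forall>k::nat. k > 0 \<and> [k = (r * n - 1) div 3] (mod n) \<longrightarrow>
      (\<exists>A B C D :: int. A > 0 \<and> B > 0 \<and> C > 0 \<and> D > 0 \<and>
        gcd (gcd A B) C = p ^ k \<and> A + B = C \<and> A * B * C = D ^ n))"
proof (intro conjI allI impI)
  have n_odd: "odd n" using assms(1,2) prime_odd_nat by simp
  have "(of_int (p * (a + b)) :: rat) = of_int (a ^ n + b ^ n)"
  proof -
    have "(of_int (a + b) :: rat) \<noteq> 0" using assms(6) of_int_eq_0_iff by blast
    then show ?thesis by (simp only: of_int_mult assms(7)) simp
  qed
  then have eq: "p * (a + b) = a ^ n + b ^ n" by (simp only: of_int_eq_iff)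
  show "[p = 1] (mod 2 * int n)"
    using quotient_prime_cong_1 assms n_odd eq by blast
  have cop: "coprime a b" using coprime_of_prime_quotient[of n p a b] assms n_odd eq by simp
  \<comment> \<open>If one of two coprime terms vanished, the other would be a unit, and then so
    would \<open>p\<close>. The variables are generic so that this serves both \<open>a\<close> and
    \<open>b\<close>.\<close>
  have nonzero: "x \<noteq> 0" if "coprime x y" "p * (x + y) = x ^ n + y ^ n" for x y
  proof
    assume "x = 0"
    then have "is_unit y" using that(1) by simp
    moreover have "p * y = y ^ n" using that(2) \<open>x = 0\<close> assms(2) by simp
    ultimately have "is_unit p" by (metis dvd_mult_left is_unit_power_iff)
    then show False using assms(8) not_prime_unit by blast
  qed
  have "a \<noteq> 0" "b \<noteq> 0"
    using nonzero[of a b] nonzero[of b a] cop eq by (simp_all add: coprime_commute add.commute)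
  have "p > 0" using assms(8) prime_gt_0_int by blast
  fix k :: nat
  assume k: "k > 0 \<and> [k = (r * n - 1) div 3] (mod n)"
  then obtain e where e: "3 * k + 1 = n * e"
    using dvd_three_mult_add_1[of n r k] assms(2-4) by (auto elim!: dvdE)
  let ?x = "p ^ k * a ^ n" and ?y = "p ^ k * b ^ n" and ?z = "p ^ k * (p * m ^ n)"
  have "?x + ?y = ?z" using eq assms(10) by (simp add: algebra_simps)
  moreover have "?x \<noteq> 0" "?y \<noteq> 0" "?z \<noteq> 0"
    using \<open>a \<noteq> 0\<close> \<open>b \<noteq> 0\<close> \<open>m \<noteq> 0\<close> \<open>p > 0\<close> by simp_all
  ultimately obtain A B C where ABC: "A > 0" "B > 0" "C > 0" "A + B = C"
    "gcd (gcd A B) C = gcd (gcd ?x ?y) ?z" "A * B * C = \<bar>?x * ?y * ?z\<bar>"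
    using exists_positive_sum_triple[of ?x ?y ?z] by blast
  \<comment> \<open>Coprimality of \<open>a\<close> and \<open>b\<close> leaves only the common
    factor \<open>p ^ k\<close>, which also divides \<open>?z\<close>.\<close>
  have "gcd ?x ?y = p ^ k"
    using cop \<open>p > 0\<close> by (simp add: gcd_mult_left coprime_iff_gcd_eq_1[symmetric])
  then have "gcd (gcd A B) C = p ^ k"
    using ABC(5) \<open>p > 0\<close> by (simp add: gcd_proj1_if_dvd)
  \<comment> \<open>Each of the three terms contributes \<open>p ^ k\<close>, and \<open>?z\<close>
    one further \<open>p\<close>; the exponent \<open>3 * k + 1 = n * e\<close> gives the factor
    \<open>p ^ e\<close> of \<open>D\<close>. The absolute value makes \<open>D\<close>
    positive.\<close>
  moreover have "A * B * C = (p ^ e * \<bar>a * b * m\<bar>) ^ n"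
  proof -
    have "?x * ?y * ?z = p ^ (3 * k + 1) * (a * b * m) ^ n"
      by (simp add: power_mult_distrib numeral_3_eq_3 power_add algebra_simps)
    also have "\<dots> = (p ^ e * (a * b * m)) ^ n"
      by (simp only: e mult.commute[of n e] power_mult power_mult_distrib)
    finally show ?thesis using ABC(6) \<open>p > 0\<close> by (simp add: power_abs abs_mult)
  qed
  moreover have "p ^ e * \<bar>a * b * m\<bar> > 0"
    using \<open>a \<noteq> 0\<close> \<open>b \<noteq> 0\<close> \<open>m \<noteq> 0\<close> \<open>p > 0\<close> by simp
  ultimately show "\<exists>A B C D :: int. A > 0 \<and> B > 0 \<and> C > 0 \<and> D > 0 \<and>
      gcd (gcd A B) C = p ^ k \<and> A + B = C \<and> A * B * C = D ^ n"
    using ABC(1-4) by blast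
qed

end
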